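(* Let $Y$ be a locally compact, $\sigma$-compact Hausdorff space and $q:Y\to X$ a quotient map with $X$ Hausdorff and a Fréchet-Urysohn space. Let $q_*:Y_*\to X$ be the associated map on the Fell-closure $Y_*$ of the set of fibres of $q$, and let $L_{q_*}$ be the set of $x\in X$ such that $q_*$ is locally closed at $x$ and $q_*^{-1}(x)$ has compact boundary in $Y_*$. Then: (i) $q_*$ is closed and $L_{q_*}$ is a dense open subset of $X$ with discrete complement; (ii) if $Y$ is hereditarily Lindelöf then $X$ is first countable at each point of $L_{q_*}$.
   Context: Fell topology: $\operatorname{Cl}(Y)$ is the set of all closed subsets of $Y$ (including $\emptyset$), with base of open sets $U(K,\Phi)=\{S\in\operatorname{Cl}(Y): S\cap K=\emptyset,\ S\cap O\neq\emptyset \text{ for all } O\in\Phi\}$, where $K$ ranges over compact subsets of $Y$ and $\Phi$ over finite families of open subsets of $Y$. $Y_*$ is the closure of $\{q^{-1}(x):x\in X\}$ in $\operatorname{Cl}(Y)\setminus\{\emptyset\}$ (with the subspace topology). Every $F\in Y_*$ is nonempty and contained in a single fibre of $q$, and $q_*:Y_*\to X$ is defined by $q_*(F)=q(y)$ for any $y\in F$. A map $p:Z\to X$ is locally closed at $x\in X$ if for every closed set $W\subseteq Z$, $x\in\overline{p(W)}$ implies $x\in p(W)$. A space $X$ is Fréchet-Urysohn if whenever $E\subseteq X$ and $x\in\overline E$ there is a sequence in $E$ converging to $x$. *)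

theory Defs
  imports "HOL-Analysis.Analysis"
begin

definition sigma_compact_space :: "'a topology \<Rightarrow> bool" where
  "sigma_compact_space X \<longleftrightarrow>
     (\<exists>\<K>. countable \<K> \<and> (\<forall>K\<in>\<K>. compactin X K) \<and> \<Union>\<K> = topspace X)"

definition Frechet_Urysohn_space :: "'a topology \<Rightarrow> bool" where
  "Frechet_Urysohn_space X \<longleftrightarrow>
     (\<forall>E x. E \<subseteq> topspace X \<and> x \<in> X closure_of E \<longrightarrow>
        (\<exists>s :: nat \<Rightarrow> 'a. range s \<subseteq> E \<and> limitin X s x sequentially))"

definition first_countable_at :: "'a topology \<Rightarrow> 'a \<Rightarrow> bool" where
  "first_countable_at X x \<longleftrightarrow>
     (\<exists>\<B>. countable \<B> \<and> (\<forall>V\<in>\<B>. openin X V) \<and>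
          (\<forall>U. openin X U \<and> x \<in> U \<longrightarrow> (\<exists>V\<in>\<B>. x \<in> V \<and> V \<subseteq> U)))"

lemma first_countable_iff_first_countable_at:
  "first_countable X \<longleftrightarrow> (\<forall>x\<in>topspace X. first_countable_at X x)"
  by (simp add: first_countable_def first_countable_at_def)

definition locally_closed_at :: "'a topology \<Rightarrow> 'b topology \<Rightarrow> ('a \<Rightarrow> 'b) \<Rightarrow> 'b \<Rightarrow> bool" where
  "locally_closed_at Z X p x \<longleftrightarrow>
     (\<forall>W. closedin Z W \<and> x \<in> X closure_of (p ` W) \<longrightarrow> x \<in> p ` W)"


subsection \<open>The Fell topology\<close>

definition fell_basic :: "'a topology \<Rightarrow> 'a set \<Rightarrow> 'a set set \<Rightarrow> 'a set set" where
  "fell_basic Y K \<Phi> = {S. closedin Y S \<and> S \<inter> K = {} \<and> (\<forall>O'\<in>\<Phi>. S \<inter> O' \<noteq> {})}"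

definition fell_base :: "'a topology \<Rightarrow> 'a set set \<Rightarrow> bool" where
  "fell_base Y \<U> \<longleftrightarrow>
     (\<exists>K \<Phi>. compactin Y K \<and> finite \<Phi> \<and> (\<forall>O'\<in>\<Phi>. openin Y O') \<and> \<U> = fell_basic Y K \<Phi>)"

definition fell_topology :: "'a topology \<Rightarrow> 'a set topology" where
  "fell_topology Y = topology (arbitrary union_of fell_base Y)"

lemma fell_basic_Int: "fell_basic Y K \<Phi> \<inter> fell_basic Y K' \<Phi>' = fell_basic Y (K \<union> K') (\<Phi> \<union> \<Phi>')"
  by (auto simp: fell_basic_def)

lemma fell_base_Int:
  assumes "fell_base Y \<U>" "fell_base Y \<V>"
  shows "fell_base Y (\<U> \<inter> \<V>)"
proof -
  obtain K \<Phi> where 1: "compactin Y K" "finite \<Phi>" "\<forall>O'\<in>\<Phi>. openin Y O'"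
      "\<U> = fell_basic Y K \<Phi>"
    using assms(1) unfolding fell_base_def by blast
  obtain K' \<Phi>' where 2: "compactin Y K'" "finite \<Phi>'" "\<forall>O'\<in>\<Phi>'. openin Y O'"
      "\<V> = fell_basic Y K' \<Phi>'"
    using assms(2) unfolding fell_base_def by blast
  have "compactin Y (K \<union> K')" "finite (\<Phi> \<union> \<Phi>')" "\<forall>O'\<in>\<Phi> \<union> \<Phi>'. openin Y O'"
    using 1 2 by (auto intro: compactin_Un)
  moreover have "\<U> \<inter> \<V> = fell_basic Y (K \<union> K') (\<Phi> \<union> \<Phi>')"
    using 1(4) 2(4) by (simp add: fell_basic_Int)
  ultimately show ?thesis
    unfolding fell_base_def by blast
qed

lemma openin_fell_topology: "openin (fell_topology Y) = arbitrary union_of fell_base Y"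
  unfolding fell_topology_def
  by (rule topology_inverse', rule istopology_base, rule fell_base_Int)

lemma openin_fell_basic:
  assumes "compactin Y K" "finite \<Phi>" "\<And>O'. O' \<in> \<Phi> \<Longrightarrow> openin Y O'"
  shows "openin (fell_topology Y) (fell_basic Y K \<Phi>)"
  unfolding openin_fell_topology
  by (rule arbitrary_union_of_inc) (use assms in \<open>auto simp: fell_base_def\<close>)

lemma topspace_fell_topology [simp]: "topspace (fell_topology Y) = {S. closedin Y S}"
proof
  have "fell_basic Y {} {} = {S. closedin Y S}"
    by (simp add: fell_basic_def)
  with openin_fell_basic[of Y "{}" "{}"] show "{S. closedin Y S} \<subseteq> topspace (fell_topology Y)"
    by (metis compactin_empty empty_iff finite.emptyI openin_subset)
next
  have "S \<in> {S. closedin Y S}" if S: "S \<in> topspace (fell_topology Y)" for S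
  proof -
    have "(arbitrary union_of fell_base Y) (topspace (fell_topology Y))"
      by (metis openin_fell_topology openin_topspace)
    with S obtain \<U> where "fell_base Y \<U>" "S \<in> \<U>"
      by (fastforce simp: union_of_def)
    then show ?thesis
      by (auto simp: fell_base_def fell_basic_def)
  qed
  then show "topspace (fell_topology Y) \<subseteq> {S. closedin Y S}"
    by blast
qed


subsection \<open>The space \<open>Y\<^sub>*\<close> and the map \<open>q\<^sub>*\<close>\<close>

definition fibre :: "'b topology \<Rightarrow> ('b \<Rightarrow> 'a) \<Rightarrow> 'a \<Rightarrow> 'b set" where
  "fibre Y q x = {y \<in> topspace Y. q y = x}"

definition nonempty_fell :: "'b topology \<Rightarrow> 'b set topology" where
  "nonempty_fell Y = subtopology (fell_topology Y) (topspace (fell_topology Y) - {{}})"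

definition star_space :: "'a topology \<Rightarrow> 'b topology \<Rightarrow> ('b \<Rightarrow> 'a) \<Rightarrow> 'b set topology" where
  "star_space X Y q =
     subtopology (nonempty_fell Y) (nonempty_fell Y closure_of (fibre Y q ` topspace X))"

text \<open>The image \<open>q ` F\<close> is a singleton for each \<open>F\<close> in \<open>star_space X Y q\<close>; see
  \<open>star_map_eq\<close> below.\<close>

definition star_map :: "('b \<Rightarrow> 'a) \<Rightarrow> 'b set \<Rightarrow> 'a" where
  "star_map q F = the_elem (q ` F)"

definition L_set :: "'a topology \<Rightarrow> 'b topology \<Rightarrow> ('b \<Rightarrow> 'a) \<Rightarrow> 'a set" where
  "L_set X Y q =
     {x \<in> topspace X.
        locally_closed_at (star_space X Y q) X (star_map q) x \<and>
        compactin (star_space X Y q)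
          (star_space X Y q frontier_of fibre (star_space X Y q) (star_map q) x)}"

lemma star_space_in_fibre:
  assumes "Hausdorff_space X" and q: "continuous_map Y X q"
    and F: "F \<in> topspace (star_space X Y q)"
  shows "F \<noteq> {}" and "\<And>y z. y \<in> F \<Longrightarrow> z \<in> F \<Longrightarrow> q y = q z"
proof -
  have F': "closedin Y F" "F \<noteq> {}" "F \<in> nonempty_fell Y closure_of (fibre Y q ` topspace X)"
    using F by (auto simp: star_space_def nonempty_fell_def)
  then show "F \<noteq> {}" by simp
  fix y z assume yz: "y \<in> F" "z \<in> F"
  then have Y: "y \<in> topspace Y" "z \<in> topspace Y"
    using F'(1) closedin_subset by blast+
  then have X: "q y \<in> topspace X" "q z \<in> topspace X"
    using q by (auto simp: continuous_map_def)
  show "q y = q z"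
  proof (rule ccontr)
    assume "q y \<noteq> q z"
    then obtain U V where UV: "openin X U" "openin X V" "q y \<in> U" "q z \<in> V" "disjnt U V"
      using assms(1) X unfolding Hausdorff_space_def by blast
    define A where "A = {w \<in> topspace Y. q w \<in> U}"
    define B where "B = {w \<in> topspace Y. q w \<in> V}"
    have AB: "openin Y A" "openin Y B"
      unfolding A_def B_def using q UV by (auto intro: openin_continuous_map_preimage)
    then have "openin (fell_topology Y) (fell_basic Y {} {A, B})"
      by (intro openin_fell_basic) auto
    then have op: "openin (nonempty_fell Y)
        ((topspace (fell_topology Y) - {{}}) \<inter> fell_basic Y {} {A, B})" (is "openin _ ?W")
      unfolding nonempty_fell_def by (rule openin_subtopology_Int2)
    have "y \<in> F \<inter> A" "z \<in> F \<inter> B"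
      using yz Y UV(3,4) by (simp_all add: A_def B_def)
    then have "F \<inter> A \<noteq> {}" "F \<inter> B \<noteq> {}"
      by blast+
    then have "F \<in> ?W"
      using F'(1,2) by (simp add: fell_basic_def)
    moreover have "\<forall>T. F \<in> T \<and> openin (nonempty_fell Y) T \<longrightarrow> (\<exists>G. G \<in> fibre Y q ` topspace X \<and> G \<in> T)"
      using F'(3) unfolding in_closure_of by (rule conjunct2)
    ultimately have "\<exists>G. G \<in> fibre Y q ` topspace X \<and> G \<in> ?W"
      using op by (metis (no_types))
    then obtain x where x: "fibre Y q x \<in> fell_basic Y {} {A, B}"
      by auto
    from x obtain v w where "v \<in> fibre Y q x" "v \<in> A" "w \<in> fibre Y q x" "w \<in> B"
      unfolding fell_basic_def by auto
    then show False
      using UV(5) by (auto simp: fibre_def A_def B_def disjnt_iff)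
  qed
qed

lemma star_map_eq:
  assumes "Hausdorff_space X" "continuous_map Y X q" "F \<in> topspace (star_space X Y q)" "y \<in> F"
  shows "star_map q F = q y"
proof -
  have "q ` F = {q y}"
    using star_space_in_fibre(2)[OF assms(1-3)] assms(4) by blast
  then show ?thesis
    by (simp add: star_map_def)
qed

end

(*
  Let K_m be a compact exhaustion of Y. In the Fell topology the closed sets meeting a fixed compact
  set form a compact set, so a closed noncompact subset of Y_* contains, for each m, some F missing
  K_m, and q_* F then lies in the closure of X - q(K_m). No sequence of points x_n different from x
  with x_n in the closure of X - q(K_n) converges to x: by the Frechet-Urysohn property a diagonal
  sequence of points of X - q(K_n), n tending to infinity, would converge to x, but its fibres form a
  locally finite family, so its range is closed. Applied to points of q_* W this shows that q_* is
  closed; applied to points outside L it shows that every subset of X - L is closed. At x in L,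
  closedness of q_* and compactness of the boundary give a neighbourhood V of x inside
  {x} \<union> q(K_m); removing from V the images of compact sets that exhaust Y - q^{-1}(x) yields a
  countable base at x.
*)
theory Submission
  imports Defs
begin

section \<open>Compactness in the Fell topology\<close>

text \<open>By Alexander's subbase theorem, only covers by miss sets of compact sets and hit sets of
  open sets need finite subcovers. The complement of the union of the open sets whose hit sets occur
  tells which members of the cover to choose.\<close>

lemma compactin_fell_hit:
  assumes K: "compactin Y K"
  shows "compactin (fell_topology Y) {S. closedin Y S \<and> S \<inter> K \<noteq> {}}"
proof -
  define miss where "miss C = {S. closedin Y S \<and> S \<inter> C = {}}" for C
  define hit where "hit C = {S. closedin Y S \<and> S \<inter> C \<noteq> {}}" for C
  define B where "B = miss ` {C. compactin Y C} \<union> hit ` {O'. openin Y O'}"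
  define T where "T = topology (arbitrary union_of (finite intersection_of (\<lambda>x. x \<in> B) relative_to hit K))"
  have topT: "topspace T = hit K"
    unfolding T_def by (rule topspace_subbase)
  have "compact_space T"
  proof (rule Alexander_subbase_alt[OF _ _ T_def[symmetric]])
    have "miss {} \<in> B" by (auto simp: B_def)
    then show "hit K \<subseteq> \<Union>B" by (auto simp: miss_def hit_def)
  next
    fix C assume C: "C \<subseteq> B" "hit K \<subseteq> \<Union>C"
    define G where "G = {O'. openin Y O' \<and> hit O' \<in> C}"
    \<comment> \<open>A closed set meeting \<open>L\<close> meets a member of any open cover of
      \<open>L\<close>, so a finite subcover of \<open>L\<close> turns into finitely many hit sets
      covering \<open>hit L\<close>.\<close>
    have cov: "\<exists>D. finite D \<and> D \<subseteq> C \<and> hit L \<subseteq> \<Union>D"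
      if L: "compactin Y L" "L \<subseteq> \<Union>G" for L
    proof -
      have "\<exists>F. finite F \<and> F \<subseteq> G \<and> L \<subseteq> \<Union>F"
        using L by (intro compactinD) (auto simp: G_def)
      then obtain F where F: "finite F" "F \<subseteq> G" "L \<subseteq> \<Union>F" by metis
      show ?thesis
      proof (intro exI[of _ "hit ` F"] conjI)
        show "finite (hit ` F)" "hit ` F \<subseteq> C" using F by (auto simp: G_def)
        show "hit L \<subseteq> \<Union>(hit ` F)" using F(3) by (auto simp: hit_def)
      qed
    qed
    \<comment> \<open>If \<open>S\<close> misses \<open>K\<close>, the hit sets alone cover; otherwise \<open>S\<close> lies in a miss set, whose
      compact set is covered by \<open>G\<close>.\<close>
    define S where "S = topspace Y - \<Union>G"
    have S: "closedin Y S" by (auto simp: S_def G_def)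
    show "\<exists>C'. finite C' \<and> C' \<subseteq> C \<and> hit K \<subseteq> \<Union>C'"
    proof (cases "K \<subseteq> \<Union>G")
      case True
      then show ?thesis by (rule cov[OF K])
    next
      case False
      then have "S \<inter> K \<noteq> {}"
        using compactin_subset_topspace[OF K] by (auto simp: S_def)
      with S have "S \<in> hit K" by (simp add: hit_def)
      with C obtain V where V: "V \<in> C" "V \<in> B" "S \<in> V" by (metis UnionE subsetD)
      have "S \<notin> hit O'" if "openin Y O'" "hit O' \<in> C" for O'
        using that by (auto simp: hit_def S_def G_def)
      with V have "V \<in> miss ` {C. compactin Y C}" by (auto simp: B_def)
      then obtain L where L: "compactin Y L" "V = miss L" by (elim imageE) simp
      have "S \<inter> L = {}" using V(3) by (simp add: L(2) miss_def)
      then have "L \<subseteq> \<Union>G"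
        using compactin_subset_topspace[OF L(1)] by (auto simp: S_def)
      then obtain D where D: "finite D" "D \<subseteq> C" "hit L \<subseteq> \<Union>D"
        using cov[OF L(1)] by metis
      have "hit K \<subseteq> miss L \<union> hit L" by (auto simp: hit_def miss_def)
      then have "hit K \<subseteq> \<Union>(insert V D)" using D(3) L(2) by auto
      then show ?thesis using V(1) D by (intro exI[of _ "insert V D"]) simp
    qed
  qed
  have opT: "openin T (hit K \<inter> V)" if "V \<in> B" for V
    unfolding T_def openin_subbase
    using that by (intro arbitrary_union_of_inc relative_to_inc finite_intersection_of_inc)
  have opbase: "openin T (hit K \<inter> U)" if U: "fell_base Y U" for U
  proof -
    obtain L \<Phi> where L: "compactin Y L" "finite \<Phi>" "\<forall>O'\<in>\<Phi>. openin Y O'" "U = fell_basic Y L \<Phi>"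
      using U unfolding fell_base_def by metis
    \<comment> \<open>The factor \<open>topspace T\<close> makes the finite intersection open also
      when \<open>\<Phi>\<close> is empty.\<close>
    have "hit K \<inter> U = (hit K \<inter> miss L) \<inter> ((\<Inter>O'\<in>\<Phi>. hit K \<inter> hit O') \<inter> topspace T)"
      unfolding L(4) fell_basic_def miss_def hit_def topT by auto
    also have "openin T \<dots>"
      using L by (intro openin_Int openin_INT opT) (auto simp: B_def)
    finally show ?thesis .
  qed
  \<comment> \<open>One direction of the comparison with the Fell topology suffices: a continuous
    identity map carries compactness over.\<close>
  have "continuous_map T (fell_topology Y) id"
    unfolding continuous_map
  proof (intro conjI allI impI)
    show "id ` topspace T \<subseteq> topspace (fell_topology Y)" by (auto simp: topT hit_def)
    fix U assume "openin (fell_topology Y) U"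
    then obtain \<U> where U: "\<U> \<subseteq> Collect (fell_base Y)" "\<Union>\<U> = U"
      unfolding openin_fell_topology union_of_def arbitrary_def by auto
    have "{x \<in> topspace T. id x \<in> U} = \<Union>((\<inter>) (hit K) ` \<U>)"
      using U(2) unfolding topT by auto
    also have "openin T \<dots>" using U(1) opbase by (intro openin_Union) auto
    finally show "openin T {x \<in> topspace T. id x \<in> U}" .
  qed
  then have "compactin (fell_topology Y) (id ` topspace T)"
    using \<open>compact_space T\<close> image_compactin unfolding compact_space_def by metis
  then show ?thesis by (simp add: topT hit_def)
qed

section \<open>Compact exhaustions and sequential closedness\<close>

text \<open>Each of the countably many compact sets is covered by finitely many open sets with
  compact supersets. Enumerating all these open sets and taking partial unions gives both increasing
  sequences.\<close>

lemma compact_exhaustion: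
  assumes "locally_compact_space Y" and "sigma_compact_space Y"
  obtains U K :: "nat \<Rightarrow> 'b set" where
    "\<And>n. openin Y (U n)" "\<And>n. compactin Y (K n)" "\<And>n. U n \<subseteq> K n"
    "incseq U" "incseq K" "topspace Y = (\<Union>n. U n)"
proof -
  let ?\<U> = "{U. openin Y U \<and> (\<exists>K. compactin Y K \<and> U \<subseteq> K)}"
  have cov: "topspace Y \<subseteq> \<Union>?\<U>"
    using assms(1) unfolding locally_compact_space_def by fastforce
  obtain \<K> where \<K>: "countable \<K>" "\<forall>K\<in>\<K>. compactin Y K" "\<Union>\<K> = topspace Y"
    using assms(2) unfolding sigma_compact_space_def by metis
  have "\<exists>F. finite F \<and> F \<subseteq> ?\<U> \<and> K \<subseteq> \<Union>F" if "K \<in> \<K>" for K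
  proof -
    have "compactin Y K" "K \<subseteq> \<Union>?\<U>" using that \<K> cov by auto
    then show ?thesis by (intro compactinD) auto
  qed
  then obtain F where F: "\<And>K. K \<in> \<K> \<Longrightarrow> finite (F K) \<and> F K \<subseteq> ?\<U> \<and> K \<subseteq> \<Union>(F K)"
    by metis
  \<comment> \<open>Inserting the empty set makes the family nonempty, so that
    \<open>from_nat_into\<close> enumerates exactly it.\<close>
  define \<V> where "\<V> = insert {} (\<Union>K\<in>\<K>. F K)"
  have "countable (\<Union>K\<in>\<K>. F K)"
    using \<K>(1) F by (intro countable_UN) (auto intro: countable_finite)
  then have cV: "countable \<V>" "\<V> \<noteq> {}" by (auto simp: \<V>_def)
  have V: "\<V> \<subseteq> ?\<U>" using F by (auto simp: \<V>_def)
  have "K \<subseteq> \<Union>\<V>" if "K \<in> \<K>" for K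
  proof -
    have "F K \<subseteq> \<V>" using that by (auto simp: \<V>_def)
    then have "\<Union>(F K) \<subseteq> \<Union>\<V>" by (rule Union_mono)
    with F[OF that] show ?thesis by (meson order_trans)
  qed
  then have "topspace Y \<subseteq> \<Union>\<V>" unfolding \<K>(3)[symmetric] by (rule Union_least)
  moreover have "\<Union>\<V> \<subseteq> topspace Y" using V openin_subset[of Y] by (intro Union_least) blast
  ultimately have UV: "topspace Y = \<Union>\<V>" by simp
  define W where "W = from_nat_into \<V>"
  have rW: "range W = \<V>" unfolding W_def using cV by (simp add: range_from_nat_into)
  then have W: "openin Y (W n) \<and> (\<exists>K. compactin Y K \<and> W n \<subseteq> K)" for n
    using V by blast
  then obtain C where C: "\<And>n. compactin Y (C n)" "\<And>n. W n \<subseteq> C n" by metis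
  show ?thesis
  proof (rule that[of "\<lambda>n. \<Union>i\<le>n. W i" "\<lambda>n. \<Union>i\<le>n. C i"])
    show "openin Y (\<Union>i\<le>n. W i)" for n using W by (intro openin_Union) auto
    show "compactin Y (\<Union>i\<le>n. C i)" for n using C by (intro compactin_Union) auto
    show "(\<Union>i\<le>n. W i) \<subseteq> (\<Union>i\<le>n. C i)" for n using C by (intro UN_mono) auto
    show "incseq (\<lambda>n. \<Union>i\<le>n. W i)" "incseq (\<lambda>n. \<Union>i\<le>n. C i)"
      by (intro monoI UN_mono; auto)+
    show "topspace Y = (\<Union>n. \<Union>i\<le>n. W i)" using UV rW by auto
  qed
qed

lemma Frechet_Urysohn_closedin:
  assumes "Frechet_Urysohn_space X" "S \<subseteq> topspace X"
    and "\<And>s x. range s \<subseteq> S \<Longrightarrow> limitin X s x sequentially \<Longrightarrow> x \<in> S"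
  shows "closedin X S"
proof -
  have "X closure_of S \<subseteq> S"
    using assms unfolding Frechet_Urysohn_space_def by (metis subsetI)
  then show ?thesis using assms(2) closure_of_subset_eq by blast
qed

section \<open>The quotient setting and basic properties of \<open>Z\<close> and
  \<open>p\<close>\<close>

text \<open>Both sequences are kept because they do different work: the sets \<open>U n\<close>
  provide neighbourhoods in \<open>Y\<close> and open hit sets, the sets \<open>K n\<close> provide
  compact hit sets and closed images in \<open>X\<close>.\<close>

locale exhausted_quotient =
  fixes X :: "'a topology" and Y :: "'b topology" and q :: "'b \<Rightarrow> 'a"
    and U K :: "nat \<Rightarrow> 'b set"
  assumes hausX: "Hausdorff_space X" and FU: "Frechet_Urysohn_space X"
    and quot: "quotient_map Y X q"
    and opU: "\<And>n. openin Y (U n)" and comK: "\<And>n. compactin Y (K n)"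
    and UK: "\<And>n. U n \<subseteq> K n" and incU: "incseq U" and incK: "incseq K"
    and covU: "topspace Y = (\<Union>n. U n)"
begin

abbreviation "Z \<equiv> star_space X Y q"
abbreviation "p \<equiv> star_map q"

lemma contq: "continuous_map Y X q"
  using quot by (rule quotient_imp_continuous_map)

lemma surjq: "q ` topspace Y = topspace X"
  using quot by (rule quotient_imp_surjective_map)

lemma UK_covers:
  assumes "y \<in> topspace Y"
  obtains m where "y \<in> U m" "y \<in> K m"
  using assms covU UK by blast

lemma closedin_fibre:
  assumes "x \<in> topspace X"
  shows "closedin Y (fibre Y q x)"
proof -
  have "closedin X {x}" using hausX assms by (simp add: closedin_Hausdorff_sing_eq)
  from closedin_continuous_map_preimage[OF contq this] show ?thesis
    by (simp add: fibre_def)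
qed

lemma topspace_star:
  assumes "F \<in> topspace Z"
  shows "closedin Y F" "F \<noteq> {}" "F \<subseteq> topspace Y"
  using assms closedin_subset by (auto simp: star_space_def nonempty_fell_def)

lemma topspace_star_eq: "topspace Z = nonempty_fell Y closure_of (fibre Y q ` topspace X)"
  unfolding star_space_def using closure_of_subset_topspace by (metis inf.absorb2 topspace_subtopology)

lemma fibre_in_star:
  assumes "x \<in> topspace X"
  shows "fibre Y q x \<in> topspace Z"
proof -
  have "fibre Y q z \<in> topspace (nonempty_fell Y)" if "z \<in> topspace X" for z
  proof -
    have "z \<in> q ` topspace Y" using that surjq by simp
    then have "fibre Y q z \<noteq> {}" by (auto simp: fibre_def)
    then show ?thesis using closedin_fibre[OF that] by (simp add: nonempty_fell_def)
  qed
  then have "fibre Y q ` topspace X \<subseteq> nonempty_fell Y closure_of (fibre Y q ` topspace X)"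
    by (intro closure_of_subset) auto
  then show ?thesis using assms unfolding topspace_star_eq by blast
qed

lemma star_map_value:
  assumes "F \<in> topspace Z" "y \<in> F"
  shows "p F = q y"
  using star_map_eq[OF hausX contq assms] .

lemma star_map_in: "F \<in> topspace Z \<Longrightarrow> p F \<in> topspace X"
  using topspace_star[of F] star_map_value[of F] surjq by (metis ex_in_conv image_eqI subsetD)

lemma star_map_fibre:
  assumes "x \<in> topspace X"
  shows "p (fibre Y q x) = x"
proof -
  obtain y where "y \<in> fibre Y q x" using topspace_star(2)[OF fibre_in_star[OF assms]] by auto
  then show ?thesis using star_map_value[OF fibre_in_star[OF assms]] by (auto simp: fibre_def)
qed

lemma openin_star_basic:
  assumes "compactin Y C" "finite \<Phi>" "\<And>O'. O' \<in> \<Phi> \<Longrightarrow> openin Y O'"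
  shows "openin Z (topspace Z \<inter> fell_basic Y C \<Phi>)"
proof -
  have "Z = subtopology (fell_topology Y) (topspace Z)"
    unfolding star_space_def nonempty_fell_def
    by (metis subtopology_subtopology subtopology_restrict topspace_subtopology inf_assoc)
  with openin_fell_basic[OF assms] show ?thesis
    by (metis openin_subtopology_Int2)
qed

lemma openin_star_hit:
  assumes "openin Y O'"
  shows "openin Z {F \<in> topspace Z. F \<inter> O' \<noteq> {}}"
proof -
  have "{F \<in> topspace Z. F \<inter> O' \<noteq> {}} = topspace Z \<inter> fell_basic Y {} {O'}"
    using topspace_star(1) by (auto simp: fell_basic_def)
  then show ?thesis using openin_star_basic[of "{}" "{O'}"] assms by simp
qed

lemma openin_star_miss:
  assumes "compactin Y C"
  shows "openin Z {F \<in> topspace Z. F \<inter> C = {}}"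
proof -
  have "{F \<in> topspace Z. F \<inter> C = {}} = topspace Z \<inter> fell_basic Y C {}"
    using topspace_star(1) by (auto simp: fell_basic_def)
  then show ?thesis using openin_star_basic[of C "{}"] assms by simp
qed

text \<open>A set that meets \<open>C\<close> is nonempty, so passing to nonempty closed sets loses
  nothing. There \<open>Z\<close> is a closed subspace, and closed parts of compact sets are
  compact.\<close>

lemma compactin_star_hit:
  assumes "compactin Y C"
  shows "compactin Z {F \<in> topspace Z. F \<inter> C \<noteq> {}}"
proof -
  let ?H = "{S. closedin Y S \<and> S \<inter> C \<noteq> {}}"
  have "compactin (nonempty_fell Y) ?H"
    unfolding nonempty_fell_def compactin_subtopology
    using compactin_fell_hit[OF assms] by auto
  then have "compactin (nonempty_fell Y) (topspace Z \<inter> ?H)"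
    unfolding topspace_star_eq by (intro closed_Int_compactin closedin_closure_of)
  then have "compactin (subtopology (nonempty_fell Y) (topspace Z)) (topspace Z \<inter> ?H)"
    by (simp add: compactin_subtopology)
  moreover have "subtopology (nonempty_fell Y) (topspace Z) = Z"
    unfolding topspace_star_eq by (rule star_space_def[symmetric])
  moreover have "topspace Z \<inter> ?H = {F \<in> topspace Z. F \<inter> C \<noteq> {}}"
    using topspace_star(1) by auto
  ultimately show ?thesis by simp
qed

lemma fibres_dense:
  assumes "openin Z W" "F \<in> W"
  obtains x where "x \<in> topspace X" "fibre Y q x \<in> W"
proof -
  obtain V where V: "openin (nonempty_fell Y) V" "W = V \<inter> topspace Z"
    using assms(1) unfolding topspace_star_eq by (auto simp: star_space_def openin_subtopology)
  then have "F \<in> V" "F \<in> nonempty_fell Y closure_of (fibre Y q ` topspace X)"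
    using assms(2) by (auto simp: topspace_star_eq)
  with V(1) obtain x where "x \<in> topspace X" "fibre Y q x \<in> V"
    unfolding in_closure_of by (metis imageE)
  with V(2) show ?thesis using that fibre_in_star by blast
qed

text \<open>Since \<open>F\<close> is nonempty and lies in one fibre, \<open>p F\<close> is in
  \<open>V\<close> exactly when \<open>F\<close> hits the preimage of \<open>V\<close>, which is an
  open condition.\<close>

lemma continuous_star_map: "continuous_map Z X p"
  unfolding continuous_map
proof (intro conjI allI impI)
  show "p ` topspace Z \<subseteq> topspace X" using star_map_in by blast
  fix V assume V: "openin X V"
  have "{F \<in> topspace Z. p F \<in> V} = {F \<in> topspace Z. F \<inter> {y \<in> topspace Y. q y \<in> V} \<noteq> {}}"
    (is "?L = ?R")
  proof (intro equalityI subsetI)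
    fix F assume F: "F \<in> ?L"
    then obtain y where "y \<in> F" using topspace_star(2) by blast
    then show "F \<in> ?R" using F topspace_star(3)[of F] star_map_value[of F y] by auto
  next
    fix F assume "F \<in> ?R"
    then show "F \<in> ?L" using star_map_value by auto
  qed
  also have "openin Z \<dots>"
    by (intro openin_star_hit openin_continuous_map_preimage[OF contq V])
  finally show "openin Z {F \<in> topspace Z. p F \<in> V}" .
qed

section \<open>Sequences that escape the images of the compact sets\<close>

lemma star_map_missing:
  assumes C: "compactin Y C" and F: "F \<in> topspace Z" "F \<inter> C = {}"
  shows "p F \<in> X closure_of (topspace X - q ` C)"
  unfolding in_closure_of
proof (intro conjI allI impI)
  show "p F \<in> topspace X" using star_map_in F(1) .
  fix V assume V: "p F \<in> V \<and> openin X V"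
  define W where "W = {F \<in> topspace Z. F \<inter> C = {}} \<inter> {F \<in> topspace Z. p F \<in> V}"
  have "openin Z W"
    unfolding W_def using V
    by (intro openin_Int openin_star_miss C openin_continuous_map_preimage[OF continuous_star_map]) auto
  moreover have "F \<in> W" using F V by (simp add: W_def)
  ultimately obtain x where x: "x \<in> topspace X" "fibre Y q x \<in> W" by (rule fibres_dense)
  then have "x \<in> V" "fibre Y q x \<inter> C = {}" by (auto simp: W_def star_map_fibre)
  moreover have "C \<subseteq> topspace Y" using C compactin_subset_topspace by blast
  ultimately show "\<exists>y. y \<in> topspace X - q ` C \<and> y \<in> V"
    using x(1) by (intro exI[of _ x]) (auto simp: fibre_def)
qed

text \<open>The fibres over a sequence leaving every \<open>q ` K m\<close> form a locally finite family, so their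
  union is closed and so is the range of the sequence.\<close>

lemma escaping_sequence_no_limit:
  assumes s: "range s \<subseteq> topspace X" and esc: "\<And>m. eventually (\<lambda>n::nat. s n \<notin> q ` K m) sequentially"
    and lim: "limitin X s x sequentially"
  shows "x \<in> range s"
proof -
  define P where "P = {y \<in> topspace Y. q y \<in> range s}"
  have "closedin X (range s)"
  proof -
    have "openin Y (topspace Y - P)"
    proof (subst openin_subopen, intro ballI)
      fix y assume y: "y \<in> topspace Y - P"
      then obtain m where m: "y \<in> U m" using UK_covers by blast
      obtain N where N: "\<And>n. n \<ge> N \<Longrightarrow> s n \<notin> q ` K m"
        using esc[of m] unfolding eventually_sequentially by blast
      \<comment> \<open>Points of \<open>U m\<close> lie in \<open>K m\<close>, hence over no
        \<open>s n\<close> with \<open>n \<ge> N\<close>. The finitely many other fibres are closed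
        and can be removed.\<close>
      define T where "T = U m - (\<Union>n<N. fibre Y q (s n))"
      have "openin Y T"
        unfolding T_def
        by (intro openin_diff closedin_Union opU) (use s closedin_fibre in \<open>auto simp: range_subsetD\<close>)
      moreover have "y \<in> T" using y m by (auto simp: T_def P_def fibre_def)
      moreover have "T \<subseteq> topspace Y - P"
      proof
        fix z assume z: "z \<in> T"
        have zY: "z \<in> topspace Y" using z opU openin_subset unfolding T_def by blast
        have "q z \<noteq> s n" for n
        proof (cases "n < N")
          case True
          then show ?thesis using z zY by (auto simp: T_def fibre_def)
        next
          case False
          then have "s n \<notin> q ` K m" using N by simp
          moreover have "z \<in> K m" using z UK by (auto simp: T_def)
          ultimately show ?thesis by force
        qed
        then show "z \<in> topspace Y - P" using zY by (auto simp: P_def)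
      qed
      ultimately show "\<exists>T. openin Y T \<and> y \<in> T \<and> T \<subseteq> topspace Y - P" by metis
    qed
    then have "closedin Y P" by (auto simp: closedin_def P_def)
    moreover have "closedin Y P \<longleftrightarrow> closedin X (range s)"
      using quot s unfolding P_def quotient_map_closedin by presburger
    ultimately show ?thesis by simp
  qed
  then show ?thesis
    using limitin_closedin[OF lim] by simp
qed

text \<open>Terms are only in closures of the complements, so each is replaced by nearby points that
  really lie in a complement. The Frechet-Urysohn property extracts from these a sequence to which
  \<open>escaping_sequence_no_limit\<close> applies.\<close>

lemma not_limit_of_escape_points:
  assumes neq: "\<And>n. s n \<noteq> x" and lim: "limitin X s x sequentially"
    and esc: "\<And>m. eventually (\<lambda>n::nat. s n \<in> X closure_of (topspace X - q ` K m)) sequentially"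
  shows False
proof -
  have x: "x \<in> topspace X" using lim by (simp add: limitin_def)
  obtain N where N: "\<And>m n. n \<ge> N m \<Longrightarrow> s n \<in> X closure_of (topspace X - q ` K m)"
    using esc unfolding eventually_sequentially by metis
  \<comment> \<open>Adding \<open>N m\<close> puts the term into the \<open>m\<close>-th closure;
    adding \<open>m\<close> makes the index at least \<open>m\<close>, so that \<open>t M\<close> is
    in \<open>V\<close> below.\<close>
  define t where "t m = s (m + N m)" for m
  have tcl: "t m \<in> X closure_of (topspace X - q ` K m)" for m using N by (simp add: t_def)
  have tX: "t m \<in> topspace X" for m using tcl closure_of_subset_topspace by fast
  have "\<exists>A B. openin X A \<and> openin X B \<and> t m \<in> A \<and> x \<in> B \<and> disjnt A B" for m
    using hausX tX x neq unfolding Hausdorff_space_def t_def by metis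
  then obtain A B where AB: "\<And>m. openin X (A m)" "\<And>m. openin X (B m)" "\<And>m. t m \<in> A m"
    "\<And>m. x \<in> B m" "\<And>m. disjnt (A m) (B m)" by metis
  \<comment> \<open>The neighbourhoods \<open>A m\<close> stay away from \<open>x\<close>, so a sequence in \<open>E\<close> converging
    to \<open>x\<close> runs through infinitely many of the sets forming \<open>E\<close>.\<close>
  define E where "E = (\<Union>m. A m \<inter> (topspace X - q ` K m))"
  have "x \<in> X closure_of E"
    unfolding in_closure_of
  proof (intro conjI x allI impI)
    fix V assume V: "x \<in> V \<and> openin X V"
    then obtain M where "\<And>n. n \<ge> M \<Longrightarrow> s n \<in> V"
      using lim unfolding limitin_sequentially by metis
    then have "t M \<in> V \<inter> A M" using AB(3) by (simp add: t_def)
    moreover have "openin X (V \<inter> A M)" using V AB(1) by blast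
    ultimately obtain y where "y \<in> topspace X - q ` K M" "y \<in> V \<inter> A M"
      using tcl[of M] unfolding in_closure_of by metis
    then show "\<exists>y. y \<in> E \<and> y \<in> V" unfolding E_def by blast
  qed
  moreover have "E \<subseteq> topspace X" by (auto simp: E_def)
  ultimately obtain r :: "nat \<Rightarrow> 'a" where r: "range r \<subseteq> E" "limitin X r x sequentially"
    using FU unfolding Frechet_Urysohn_space_def by metis
  have "x \<in> range r"
  proof (rule escaping_sequence_no_limit[OF _ _ r(2)])
    show "range r \<subseteq> topspace X" using r(1) \<open>E \<subseteq> topspace X\<close> by (rule order_trans)
    fix m
    have "eventually (\<lambda>n. \<forall>i\<in>{..<m}. r n \<in> B i) sequentially"
      using r(2) AB(2,4) by (intro eventually_ball_finite) (auto simp: limitin_def)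
    then show "eventually (\<lambda>n. r n \<notin> q ` K m) sequentially"
    proof (rule eventually_mono)
      fix n assume n: "\<forall>i\<in>{..<m}. r n \<in> B i"
      have "r n \<in> E" using r(1) by blast
      then obtain i where i: "r n \<in> A i" "r n \<notin> q ` K i" by (auto simp: E_def)
      \<comment> \<open>For \<open>i < m\<close> the term is already in \<open>B i\<close>, which is
        disjoint from \<open>A i\<close>.\<close>
      have "i \<ge> m"
      proof (rule ccontr)
        assume "\<not> m \<le> i"
        then have "r n \<in> B i" using n by simp
        then show False using AB(5)[of i] i(1) by (auto simp: disjnt_iff)
      qed
      then have "q ` K m \<subseteq> q ` K i" using incK by (intro image_mono) (simp add: monoD)
      then show "r n \<notin> q ` K m" using i(2) by blast
    qed
  qed
  then have "x \<in> E" using r(1) by blast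
  then obtain i where "x \<in> A i" by (auto simp: E_def)
  then show False using AB(4,5)[of i] by (auto simp: disjnt_iff)
qed

section \<open>Closedness of \<open>p\<close>\<close>

lemma closed_star_map: "closed_map Z X p"
  unfolding closed_map_def
proof (intro allI impI)
  fix W assume W: "closedin Z W"
  have WZ: "W \<subseteq> topspace Z" using W closedin_subset by blast
  show "closedin X (p ` W)"
  proof (rule Frechet_Urysohn_closedin[OF FU])
    show "p ` W \<subseteq> topspace X" using WZ star_map_in by blast
    fix s x assume s: "range s \<subseteq> p ` W" and lim: "limitin X s x sequentially"
    show "x \<in> p ` W"
    proof (rule ccontr)
      assume nx: "x \<notin> p ` W"
      have "\<exists>F. F \<in> W \<and> p F = s n" for n
        using s by (metis imageE range_subsetD)
      then obtain F where F: "\<And>n. F n \<in> W" "\<And>n. p (F n) = s n" by metis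
      show False
      proof (rule not_limit_of_escape_points[OF _ lim])
        show "s n \<noteq> x" for n using s nx by blast
        fix m
        define C where "C = p ` (W \<inter> {F \<in> topspace Z. F \<inter> K m \<noteq> {}})"
        have "closedin X C"
          unfolding C_def
          by (intro compactin_imp_closedin[OF hausX] image_compactin[OF _ continuous_star_map]
              closed_Int_compactin[OF W] compactin_star_hit comK)
        moreover have "x \<notin> C" using nx by (auto simp: C_def)
        ultimately have "eventually (\<lambda>n. s n \<in> topspace X - C) sequentially"
          using lim unfolding limitin_def by (metis Diff_iff openin_diff openin_topspace)
        then show "eventually (\<lambda>n. s n \<in> X closure_of (topspace X - q ` K m)) sequentially"
        proof (rule eventually_mono)
          fix n assume "s n \<in> topspace X - C"
          then have "p (F n) \<notin> C" by (simp add: F(2))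
          moreover have Fn: "F n \<in> topspace Z" using F(1) WZ by (rule subsetD[rotated])
          ultimately have "F n \<inter> K m = {}" using F(1)[of n] by (auto simp: C_def)
          from star_map_missing[OF comK Fn this]
          show "s n \<in> X closure_of (topspace X - q ` K m)" by (simp add: F(2))
        qed
      qed
    qed
  qed
qed

section \<open>Openness, density and discrete complement of \<open>L_set\<close>\<close>

lemma closedin_star_fibre:
  assumes "x \<in> topspace X"
  shows "closedin Z (fibre Z p x)"
proof -
  have "closedin X {x}" using hausX assms by (simp add: closedin_Hausdorff_sing_eq)
  from closedin_continuous_map_preimage[OF continuous_star_map this] show ?thesis
    by (simp add: fibre_def)
qed

text \<open>A closed map is locally closed at every point, so only the boundary condition
  remains.\<close>

lemma L_set_eq: "L_set X Y q = {x \<in> topspace X. compactin Z (Z frontier_of fibre Z p x)}"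
proof -
  have "locally_closed_at Z X p x" for x
    using closed_star_map closure_of_closedin
    unfolding locally_closed_at_def closed_map_def by metis
  then show ?thesis by (simp add: L_set_def)
qed

text \<open>The boundary is closed but not compact, so it is not contained in the compact hit set of
  \<open>K m\<close>. Some member of the fibre of \<open>p\<close> over \<open>x\<close> therefore
  misses \<open>K m\<close>.\<close>

lemma not_in_L_set:
  assumes "x \<in> topspace X" "x \<notin> L_set X Y q"
  shows "x \<in> X closure_of (topspace X - q ` K m)"
proof -
  let ?B = "Z frontier_of fibre Z p x"
  have nc: "\<not> compactin Z ?B" using assms by (simp add: L_set_eq)
  have "\<not> ?B \<subseteq> {F \<in> topspace Z. F \<inter> K m \<noteq> {}}"
  proof
    assume "?B \<subseteq> {F \<in> topspace Z. F \<inter> K m \<noteq> {}}"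
    then show False
      using nc closed_compactin[OF compactin_star_hit[OF comK[of m]] _ closedin_frontier_of] by simp
  qed
  then obtain F where F: "F \<in> ?B" "F \<in> topspace Z" "F \<inter> K m = {}"
    using frontier_of_subset_topspace[of Z "fibre Z p x"] by auto
  have "F \<in> fibre Z p x"
    using F(1) frontier_of_subset_closedin[OF closedin_star_fibre[OF assms(1)]] by blast
  then have "p F = x" by (simp add: fibre_def)
  then show ?thesis using star_map_missing[OF comK F(2,3)] by simp
qed

lemma closedin_outside_L_set:
  assumes "S \<subseteq> topspace X - L_set X Y q"
  shows "closedin X S"
proof (rule Frechet_Urysohn_closedin[OF FU])
  show "S \<subseteq> topspace X" using assms by blast
  fix s x assume s: "range s \<subseteq> S" "limitin X s x sequentially"
  show "x \<in> S"
  proof (rule ccontr)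
    assume "x \<notin> S"
    then have "s n \<noteq> x" for n using s(1) by blast
    moreover have "s n \<in> X closure_of (topspace X - q ` K m)" for n m
      using s(1) assms by (intro not_in_L_set) auto
    ultimately show False using not_limit_of_escape_points[OF _ s(2)] by simp
  qed
qed

lemma openin_L_set: "openin X (L_set X Y q)"
proof -
  have "L_set X Y q \<subseteq> topspace X" by (auto simp: L_set_def)
  then show ?thesis
    using closedin_outside_L_set[of "topspace X - L_set X Y q"] by (simp add: openin_closedin)
qed

lemma discrete_outside_L_set:
  "subtopology X (topspace X - L_set X Y q) = discrete_topology (topspace X - L_set X Y q)"
    (is "_ = discrete_topology ?D")
proof -
  have "openin (subtopology X ?D) S" if S: "S \<subseteq> ?D" for S
  proof -
    have "openin X (topspace X - (?D - S))"
      by (intro openin_diff closedin_outside_L_set) auto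
    then have "openin (subtopology X ?D) (?D \<inter> (topspace X - (?D - S)))"
      by (rule openin_subtopology_Int2)
    moreover have "?D \<inter> (topspace X - (?D - S)) = S" using S by blast
    ultimately show ?thesis by simp
  qed
  moreover have "topspace (subtopology X ?D) = ?D" by auto
  ultimately have "discrete_topology ?D = subtopology X ?D"
    unfolding discrete_topology_unique by simp
  then show ?thesis by simp
qed

text \<open>A point \<open>x\<close> outside the closure has a neighbourhood disjoint from
  \<open>L_set\<close>, all of whose subsets are closed in \<open>X\<close>, so \<open>x\<close> is
  isolated. Its fibre under \<open>p\<close> is then clopen with empty boundary, which puts
  \<open>x\<close> in \<open>L_set\<close>.\<close>

lemma dense_L_set: "X closure_of (L_set X Y q) = topspace X"
proof (rule ccontr)
  assume "X closure_of (L_set X Y q) \<noteq> topspace X"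
  then obtain x where x: "x \<in> topspace X" "x \<notin> X closure_of (L_set X Y q)"
    using closure_of_subset_topspace[of X "L_set X Y q"] by auto
  let ?V = "topspace X - X closure_of (L_set X Y q)"
  have V: "openin X ?V" by (intro openin_diff closedin_closure_of) auto
  have VL: "?V \<inter> L_set X Y q = {}"
    using closure_of_subset[of "L_set X Y q" X] by (auto simp: L_set_def)
  then have "closedin X (?V - {x})" by (intro closedin_outside_L_set) blast
  then have "openin X (?V - (?V - {x}))" using V by blast
  moreover have "?V - (?V - {x}) = {x}" using x by blast
  ultimately have "openin X {x}" by simp
  from openin_continuous_map_preimage[OF continuous_star_map this]
  have "openin Z (fibre Z p x)" by (simp add: fibre_def)
  then have "Z frontier_of fibre Z p x = {}"
    using closedin_star_fibre[OF x(1)] by (simp add: closedin_subset frontier_of_eq_empty)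
  then have "x \<in> L_set X Y q" using x(1) by (simp add: L_set_eq)
  then show False using x VL by blast
qed

section \<open>Neighbourhoods of points of \<open>L_set\<close> and first countability\<close>

lemma L_set_neighbourhood:
  assumes x: "x \<in> L_set X Y q"
  obtains m V where "openin X V" "x \<in> V" "V \<subseteq> insert x (q ` K m)"
proof -
  let ?Q = "fibre Z p x"
  define N where "N m = {F \<in> topspace Z. F \<inter> U m \<noteq> {}}" for m
  have xX: "x \<in> topspace X" and cB: "compactin Z (Z frontier_of ?Q)"
    using x by (auto simp: L_set_eq)
  have opN: "openin Z (N m)" for m unfolding N_def by (intro openin_star_hit opU)
  have "incseq N" unfolding N_def using incU by (intro monoI) (blast dest: monoD)
  have cov: "topspace Z \<subseteq> \<Union>(range N)"
  proof
    fix F assume F: "F \<in> topspace Z"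
    then obtain y where y: "y \<in> F" "y \<in> topspace Y" using topspace_star[of F] by blast
    then show "F \<in> \<Union>(range N)" using F covU by (auto simp: N_def)
  qed
  have "\<exists>\<F>. finite \<F> \<and> \<F> \<subseteq> range N \<and> Z frontier_of ?Q \<subseteq> \<Union>\<F>"
    using cov opN frontier_of_subset_topspace[of Z ?Q] by (intro compactinD[OF cB]) auto
  then obtain I where I: "finite I" "Z frontier_of ?Q \<subseteq> \<Union>(N ` I)"
    by (metis finite_subset_image)
  then obtain m where m: "\<And>i. i \<in> I \<Longrightarrow> i \<le> m" by (metis finite_nat_set_iff_bounded_le)
  have BN: "Z frontier_of ?Q \<subseteq> N m"
  proof
    fix F assume "F \<in> Z frontier_of ?Q"
    then obtain i where "i \<in> I" "F \<in> N i" using I(2) by blast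
    then show "F \<in> N m" using m monoD[OF \<open>incseq N\<close>] by blast
  qed
  \<comment> \<open>The interior together with \<open>N m\<close> covers the closed fibre
    \<open>?Q\<close>, so \<open>p\<close>
    W\<open>is closed and omits\<close>x\<open>. A point outside\<close>p \<open>W\<close> has its
    \<open>q\<close>-fibre in \<open>?Q\<close>, making the point \<open>x\<close>, or meeting
    \<open>U m\<close>.\<close>
  define W where "W = topspace Z - (Z interior_of ?Q \<union> N m)"
  have "closedin Z W"
    unfolding W_def by (intro closedin_diff closedin_topspace openin_Un openin_interior_of opN)
  then have "closedin X (p ` W)"
    using closed_star_map by (simp add: closed_map_def)
  moreover have "x \<notin> p ` W"
  proof
    assume "x \<in> p ` W"
    then obtain F where F: "F \<in> W" "F \<in> ?Q" by (auto simp: W_def fibre_def)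
    then have "F \<in> Z closure_of ?Q"
      using closure_of_subset[of ?Q Z] by (auto simp: fibre_def)
    then have "F \<in> Z interior_of ?Q \<union> Z frontier_of ?Q"
      by (simp only: interior_of_union_frontier_of)
    then show False
      using F(1) BN by (auto simp: W_def simp del: interior_of_union_frontier_of)
  qed
  moreover have "topspace X - p ` W \<subseteq> insert x (q ` K m)"
  proof
    fix y assume y: "y \<in> topspace X - p ` W"
    then have fy: "fibre Y q y \<in> topspace Z" "p (fibre Y q y) = y"
      using fibre_in_star star_map_fibre by auto
    then have "p (fibre Y q y) \<notin> p ` W" using y by simp
    then have "fibre Y q y \<notin> W" by blast
    with fy(1) consider "fibre Y q y \<in> Z interior_of ?Q" | "fibre Y q y \<in> N m"
      by (auto simp: W_def)
    then show "y \<in> insert x (q ` K m)"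
    proof cases
      case 1
      then have "fibre Y q y \<in> ?Q" using interior_of_subset[of Z ?Q] by (rule subsetD[rotated])
      then show ?thesis using fy(2) by (simp add: fibre_def)
    next
      case 2
      then obtain z where "z \<in> fibre Y q y" "z \<in> U m" by (auto simp: N_def)
      then show ?thesis using UK by (auto simp: fibre_def)
    qed
  qed
  ultimately show ?thesis using that[of "topspace X - p ` W" m] xX by blast
qed

lemma first_countable_at_L_set:
  assumes hausY: "Hausdorff_space Y" and locY: "locally_compact_space Y"
    and Lin: "hereditarily Lindelof_space Y" and x: "x \<in> L_set X Y q"
  shows "first_countable_at X x"
proof -
  obtain m V where V: "openin X V" "x \<in> V" "V \<subseteq> insert x (q ` K m)"
    using L_set_neighbourhood[OF x] .
  have xX: "x \<in> topspace X" using V openin_subset by blast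
  define P where "P = topspace Y - fibre Y q x"
  have P: "openin Y P" unfolding P_def using closedin_fibre[OF xX] by blast
  have PY: "P \<subseteq> topspace Y" by (auto simp: P_def)
  \<comment> \<open>The compact supersets stay inside \<open>P\<close>, so their images under
    \<open>q\<close> omit \<open>x\<close>.\<close>
  let ?\<G> = "{G. openin Y G \<and> (\<exists>C. compactin Y C \<and> G \<subseteq> C \<and> C \<subseteq> P)}"
  have nb: "neighbourhood_base_of (compactin Y) Y"
    using locally_compact_space_neighbourhood_base hausY locY by blast
  have "\<exists>G\<in>?\<G>. y \<in> G" if yP: "y \<in> P" for y
  proof -
    obtain G C where "openin Y G" "compactin Y C" "y \<in> G" "G \<subseteq> C" "C \<subseteq> P"
      using nb P yP unfolding neighbourhood_base_of by metis
    then show ?thesis by (intro bexI[of _ G]) auto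
  qed
  then have cov: "P \<subseteq> \<Union>?\<G>" by (meson UnionI subsetI)
  have opG: "\<forall>G\<in>?\<G>. openin Y G" by simp
  have "Lindelof_space (subtopology Y P)"
    using Lin PY by (simp add: hereditarily_def)
  then have "(\<forall>G\<in>?\<G>. openin Y G) \<and> P \<subseteq> \<Union>?\<G> \<longrightarrow> (\<exists>\<H>. countable \<H> \<and> \<H> \<subseteq> ?\<G> \<and> P \<subseteq> \<Union>\<H>)"
    unfolding Lindelof_space_subtopology_subset[OF PY] by (rule spec)
  from mp[OF this conjI[OF opG cov]]
  obtain \<H> where "countable \<H> \<and> \<H> \<subseteq> ?\<G> \<and> P \<subseteq> \<Union>\<H>" by (rule exE)
  then have H: "countable \<H>" "\<H> \<subseteq> ?\<G>" "P \<subseteq> \<Union>\<H>" by simp_all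
  have "\<forall>G\<in>\<H>. \<exists>C. compactin Y C \<and> G \<subseteq> C \<and> C \<subseteq> P" using H(2) by blast
  then obtain C where C: "\<And>G. G \<in> \<H> \<Longrightarrow> compactin Y (C G) \<and> G \<subseteq> C G \<and> C G \<subseteq> P" by metis
  \<comment> \<open>Deleting finitely many compact images from \<open>V\<close> leaves an open
    neighbourhood of \<open>x\<close>, and a countable \<open>\<H>\<close> has only countably many
    finite subfamilies.\<close>
  define D where "D \<F> = V - (\<Union>G\<in>\<F>. q ` C G)" for \<F>
  define \<B> where "\<B> = D ` {\<F>. finite \<F> \<and> \<F> \<subseteq> \<H>}"
  have opD: "openin X (D \<F>)" if "finite \<F>" "\<F> \<subseteq> \<H>" for \<F>
  proof -
    have "closedin X (q ` C G)" if "G \<in> \<F>" for G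
      using C \<open>\<F> \<subseteq> \<H>\<close> that
      by (intro compactin_imp_closedin[OF hausX] image_compactin[OF _ contq]) blast
    then show ?thesis
      unfolding D_def using V(1) that(1) by (intro openin_diff closedin_Union) auto
  qed
  have xD: "x \<in> D \<F>" if "\<F> \<subseteq> \<H>" for \<F>
  proof -
    have "x \<notin> q ` C G" if "G \<in> \<F>" for G
    proof -
      have "C G \<subseteq> P" using C \<open>\<F> \<subseteq> \<H>\<close> that by blast
      then show ?thesis by (auto simp: P_def fibre_def)
    qed
    then show ?thesis using V(2) by (auto simp: D_def)
  qed
  show ?thesis
    unfolding first_countable_at_def
  proof (intro exI[of _ \<B>] conjI allI impI)
    show "countable \<B>"
      unfolding \<B>_def using countable_Collect_finite_subset[OF H(1)] by (intro countable_image) simp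
    show "\<forall>V\<in>\<B>. openin X V" using opD by (auto simp: \<B>_def)
    fix T assume T: "openin X T \<and> x \<in> T"
    \<comment> \<open>\<open>R\<close> is the part of \<open>K m\<close> lying over points outside
      \<open>T\<close>. It is compact and inside \<open>P\<close>, so finitely many members of
      \<open>\<H>\<close> cover it; deleting their compact supersets' images removes from
      \<open>V\<close> every point outside \<open>T\<close>.\<close>
    define R where "R = (topspace Y - {y \<in> topspace Y. q y \<in> T}) \<inter> K m"
    have cR: "compactin Y R"
      unfolding R_def using T
      by (intro closed_Int_compactin comK closedin_diff openin_continuous_map_preimage[OF contq]) auto
    have "R \<subseteq> P" using T by (auto simp: R_def P_def fibre_def)
    then have "\<exists>\<F>. finite \<F> \<and> \<F> \<subseteq> \<H> \<and> R \<subseteq> \<Union>\<F>"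
      using H by (intro compactinD[OF cR]) auto
    then obtain \<F> where F: "finite \<F>" "\<F> \<subseteq> \<H>" "R \<subseteq> \<Union>\<F>" by metis
    have "D \<F> \<subseteq> T"
    proof
      fix y assume y: "y \<in> D \<F>"
      show "y \<in> T"
      proof (rule ccontr)
        assume nT: "y \<notin> T"
        then have "y \<in> q ` K m" using y V(3) T by (auto simp: D_def)
        then obtain k where k: "k \<in> K m" "y = q k" by blast
        have "k \<in> R" using k nT compactin_subset_topspace[OF comK, of m] by (auto simp: R_def)
        then obtain G where "G \<in> \<F>" "k \<in> G" using F(3) by blast
        moreover have "G \<subseteq> C G" using C F(2) \<open>G \<in> \<F>\<close> by blast
        ultimately show False using y k(2) by (auto simp: D_def)
      qed
    qed
    then show "\<exists>W\<in>\<B>. x \<in> W \<and> W \<subseteq> T"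
      using F xD by (intro bexI[of _ "D \<F>"]) (auto simp: \<B>_def)
  qed
qed

end

theorem corollary5p3:
  fixes X :: "'a topology" and Y :: "'b topology" and q :: "'b \<Rightarrow> 'a"
  assumes "locally_compact_space Y" and "sigma_compact_space Y" and "Hausdorff_space Y"
    and "quotient_map Y X q"
    and "Hausdorff_space X" and "Frechet_Urysohn_space X"
  shows "(closed_map (star_space X Y q) X (star_map q) \<and>
          openin X (L_set X Y q) \<and>
          X closure_of (L_set X Y q) = topspace X \<and>
          subtopology X (topspace X - L_set X Y q) = discrete_topology (topspace X - L_set X Y q)) \<and>
         (hereditarily Lindelof_space Y \<longrightarrow> (\<forall>x\<in>L_set X Y q. first_countable_at X x))"
proof -
  obtain U K :: "nat \<Rightarrow> 'b set" where UK: "\<And>n. openin Y (U n)" "\<And>n. compactin Y (K n)"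
      "\<And>n. U n \<subseteq> K n" "incseq U" "incseq K" "topspace Y = (\<Union>n. U n)"
    using compact_exhaustion[OF assms(1,2)] by metis
  interpret exhausted_quotient X Y q U K
    using assms(4-6) UK by unfold_locales auto
  show ?thesis
    using closed_star_map openin_L_set dense_L_set discrete_outside_L_set
      first_countable_at_L_set[OF assms(3,1)] by blast
qed

end
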